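(* Let $R$ be a right po-coherent po-ring. For every partially ordered right $R$-module $A$, the following are equivalent: (i) $A$ is finitely po-presented. (ii) $A$ is finitely related. (iii) $A$ is a finitely presented right $R$-module, and $A^+$ is a finitely generated right $R^+$-semimodule.
   Context: Rings are associative and unital; modules are unital right modules. A po-ring is a ring $R$ with a partial ordering $\leq$ such that: $x\leq y$ implies $x+z\leq y+z$, and, if $z\geq 0$, also $xz\leq yz$ and $zx\leq zy$; $R$ is directed, i.e. $R=R^++(-R^+)$ where $R^+=\{x\in R: x\geq 0\}$; and $0\leq 1$. A partially ordered right $R$-module is a right $R$-module $A$ with a partial ordering such that $x\leq y$ implies $x+z\leq y+z$ and, for $\lambda\in R^+$, $x\lambda\leq y\lambda$; $A^+=\{a\in A: a\geq 0\}$. A right $R^+$-(sub)semimodule is an additive (sub)monoid closed under right multiplication by scalars in $R^+$; it is finitely generated if it consists of all right linear combinations, with coefficients in $R^+$, of some finite subset of itself. For a set $S$, $\mathfrak{M}_{m,n}(S)$ is the set of $m\times n$ matrices with entries in $S$; matrices are ordered entrywise. A row matrix $U\in\mathfrak{M}_{1,n}(A)$ ($n\geq 1$) is spanning if its entries generate $A$ as a right $R$-module. $A$ is finitely po-presented at $U\in\mathfrak{M}_{1,n}(A)$ if $\{X\in\mathfrak{M}_{n,1}(R): UX\geq 0\}$ is a finitely generated right $R^+$-subsemimodule of $\mathfrak{M}_{n,1}(R)$; $A$ is finitely po-presented if it is finitely po-presented at some spanning row matrix (in particular $A$ is then a finitely generated right $R$-module). $A$ is finitely related at $U\in\mathfrak{M}_{1,n}(A)$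 if $\{X\in\mathfrak{M}_{n,1}(R): UX\geq 0 \text{ and } X\geq 0\}$ is a finitely generated right $R^+$-subsemimodule of $\mathfrak{M}_{n,1}(R)$; $A$ is finitely related if $A$ is a finitely generated right $R$-module and $A$ is finitely related at every spanning row matrix of elements of $A$. $A$ is po-coherent if every finitely generated submodule of $A$ (with the induced ordering) is finitely related; equivalently, $A$ is finitely related at every row matrix of elements of $A$. $R$ is right po-coherent if $R$, viewed as a partially ordered right $R$-module, is po-coherent. *)

theory Defs
  imports Main "HOL-Library.Function_Algebras"
begin

text \<open>The one-element ring is allowed, so the base is \<open>ring + monoid_mult\<close> rather than \<open>ring_1\<close>,
  and \<open>0 \<le> 1\<close> is required rather than \<open>0 < 1\<close>.\<close>

class po_ring = ordered_ring + monoid_mult +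
  assumes directed: "\<exists>y z. 0 \<le> y \<and> 0 \<le> z \<and> x = y - z"
    and zero_le_one': "0 \<le> 1"

locale po_right_module =
  fixes smul :: "'a::ordered_ab_group_add \<Rightarrow> 'r::po_ring \<Rightarrow> 'a"
  assumes smul_add_left: "smul (x + y) r = smul x r + smul y r"
    and smul_add_right: "smul x (r + t) = smul x r + smul x t"
    and smul_mult: "smul x (r * t) = smul (smul x r) t"
    and smul_one: "smul x 1 = x"
    and smul_mono: "x \<le> y \<Longrightarrow> 0 \<le> r \<Longrightarrow> smul x r \<le> smul y r"

lemma po_right_module_self: "po_right_module ((*) :: 'r::po_ring \<Rightarrow> 'r \<Rightarrow> 'r)"
  by unfold_locales (simp_all add: algebra_simps mult_right_mono)

definition nonneg :: "'r::{zero,ord} set" where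
  "nonneg = {x. 0 \<le> x}"

text \<open>The set \<open>S\<close> of scalars is \<open>nonneg\<close> for \<open>R\<^sup>+\<close>-semimodules and \<open>UNIV\<close> for \<open>R\<close>-modules; in the
  latter case closure under negation comes from multiplication by \<open>- 1\<close>.\<close>

definition right_subsemimodule ::
    "'r set \<Rightarrow> ('m::comm_monoid_add \<Rightarrow> 'r \<Rightarrow> 'm) \<Rightarrow> 'm set \<Rightarrow> bool" where
  "right_subsemimodule S s M \<longleftrightarrow>
     0 \<in> M \<and> (\<forall>x\<in>M. \<forall>y\<in>M. x + y \<in> M) \<and> (\<forall>x\<in>M. \<forall>r\<in>S. s x r \<in> M)"

definition lin_combs ::
    "'r set \<Rightarrow> ('m::comm_monoid_add \<Rightarrow> 'r \<Rightarrow> 'm) \<Rightarrow> 'm set \<Rightarrow> 'm set" where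
  "lin_combs S s G = {(\<Sum>g\<in>G. s g (c g)) | c. \<forall>g\<in>G. c g \<in> S}"

definition finitely_generated ::
    "'r set \<Rightarrow> ('m::comm_monoid_add \<Rightarrow> 'r \<Rightarrow> 'm) \<Rightarrow> 'm set \<Rightarrow> bool" where
  "finitely_generated S s M \<longleftrightarrow>
     right_subsemimodule S s M \<and> (\<exists>G. finite G \<and> G \<subseteq> M \<and> M = lin_combs S s G)"

text \<open>An \<open>n \<times> 1\<close> matrix over \<open>R\<close> is a function on \<open>nat\<close> vanishing from \<open>n\<close> on; sums and the order
  of such matrices are the pointwise ones. A \<open>1 \<times> n\<close> matrix over \<open>A\<close> is a function
  \<open>U :: nat \<Rightarrow> 'a\<close> of which only the entries \<open>U i\<close> with \<open>i < n\<close> are ever used.\<close>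

definition columns :: "nat \<Rightarrow> (nat \<Rightarrow> 'r::zero) set" where
  "columns n = {X. \<forall>i\<ge>n. X i = 0}"

definition col_smul :: "(nat \<Rightarrow> 'r::times) \<Rightarrow> 'r \<Rightarrow> nat \<Rightarrow> 'r" where
  "col_smul X r = (\<lambda>i. X i * r)"

definition row_mult ::
    "('a::comm_monoid_add \<Rightarrow> 'r \<Rightarrow> 'a) \<Rightarrow> nat \<Rightarrow> (nat \<Rightarrow> 'a) \<Rightarrow> (nat \<Rightarrow> 'r) \<Rightarrow> 'a" where
  "row_mult smul n U X = (\<Sum>i<n. smul (U i) (X i))"

text \<open>The row of the first \<open>n\<close> entries of \<open>U\<close> is spanning for the submodule \<open>M\<close>.
  Taking \<open>M = UNIV\<close> gives the notion for the whole module.\<close>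

definition spanning ::
    "('a::comm_monoid_add \<Rightarrow> 'r \<Rightarrow> 'a) \<Rightarrow> 'a set \<Rightarrow> nat \<Rightarrow> (nat \<Rightarrow> 'a) \<Rightarrow> bool" where
  "spanning smul M n U \<longleftrightarrow> 1 \<le> n \<and> U ` {..<n} \<subseteq> M \<and> M = lin_combs UNIV smul (U ` {..<n})"

definition finitely_po_presented_at ::
    "('a::ordered_ab_group_add \<Rightarrow> 'r::po_ring \<Rightarrow> 'a) \<Rightarrow> nat \<Rightarrow> (nat \<Rightarrow> 'a) \<Rightarrow> bool" where
  "finitely_po_presented_at smul n U \<longleftrightarrow>
     finitely_generated nonneg col_smul {X \<in> columns n. 0 \<le> row_mult smul n U X}"

definition finitely_po_presented ::
    "('a::ordered_ab_group_add \<Rightarrow> 'r::po_ring \<Rightarrow> 'a) \<Rightarrow> bool" where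
  "finitely_po_presented smul \<longleftrightarrow>
     (\<exists>n U. spanning smul UNIV n U \<and> finitely_po_presented_at smul n U)"

definition finitely_related_at ::
    "('a::ordered_ab_group_add \<Rightarrow> 'r::po_ring \<Rightarrow> 'a) \<Rightarrow> nat \<Rightarrow> (nat \<Rightarrow> 'a) \<Rightarrow> bool" where
  "finitely_related_at smul n U \<longleftrightarrow>
     finitely_generated nonneg col_smul {X \<in> columns n. 0 \<le> row_mult smul n U X \<and> 0 \<le> X}"

text \<open>The submodule \<open>M\<close>, with the ordering induced from the ambient module, is finitely related.\<close>

definition finitely_related ::
    "('a::ordered_ab_group_add \<Rightarrow> 'r::po_ring \<Rightarrow> 'a) \<Rightarrow> 'a set \<Rightarrow> bool" where
  "finitely_related smul M \<longleftrightarrow>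
     finitely_generated UNIV smul M \<and>
     (\<forall>n U. spanning smul M n U \<longrightarrow> finitely_related_at smul n U)"

definition po_coherent ::
    "('a::ordered_ab_group_add \<Rightarrow> 'r::po_ring \<Rightarrow> 'a) \<Rightarrow> bool" where
  "po_coherent smul \<longleftrightarrow> (\<forall>M. finitely_generated UNIV smul M \<longrightarrow> finitely_related smul M)"

text \<open>Finite presentation in the usual sense: some \<open>X \<mapsto> U X\<close> maps \<open>R\<^sup>n\<close> onto the module with
  finitely generated kernel. The order plays no role.\<close>

definition finitely_presented ::
    "('a::ab_group_add \<Rightarrow> 'r::{ring,monoid_mult} \<Rightarrow> 'a) \<Rightarrow> bool" where
  "finitely_presented smul \<longleftrightarrow>
     (\<exists>n U. spanning smul UNIV n U \<and>
        finitely_generated UNIV col_smul {X \<in> columns n. row_mult smul n U X = 0})"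

end

theory Submission
  imports Defs "HOL-Library.Product_Plus"
begin

text \<open>Throughout, an \<open>R\<close>-module is finitely generated iff it is so as an \<open>R\<^sup>+\<close>-semimodule, because \<open>R\<close>
  is directed; so it suffices to handle finitely generated cones (\<open>R\<^sup>+\<close>-semimodules). These are stable
  under linear images and sums. Coherence of \<open>R\<close> makes them stable under cutting by a halfspace
  \<open>f x \<ge> 0\<close>: if \<open>v\<close> generates the cone, pull the condition back to the coefficient vectors.
  Cutting \<open>C \<times> D\<close> by the equations \<open>x\<^sub>i = y\<^sub>i\<close> then shows that \<open>C \<inter> D\<close> is finitely
  generated for cones of columns. With \<open>C\<^sub>U = {X. U X \<ge> 0}\<close>: (ii) gives (i) by cutting \<open>R\<^sup>n\<close>, viewed
  as a cone, by \<open>U X \<ge> 0\<close>; (i) gives (iii) because \<open>ker U = C\<^sub>U \<inter> - C\<^sub>U\<close> and \<open>A\<^sup>+ = U C\<^sub>U\<close>;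
  (iii) gives (ii) because \<open>C\<^sub>W\<close> is the sum of \<open>ker W\<close>, which is finitely generated by
  Schanuel's argument, and a lift of \<open>A\<^sup>+\<close>, and the required cone is its intersection with the
  nonnegative columns.\<close>

section \<open>Modules and linear maps without order\<close>

text \<open>The order-free part of the module axioms, so that columns and pairs can serve as modules
  without a check of monotonicity.\<close>

locale right_module =
  fixes smul :: "'a::ab_group_add \<Rightarrow> 'r::{ring,monoid_mult} \<Rightarrow> 'a"
  assumes add_left: "smul (x + y) r = smul x r + smul y r"
    and add_right: "smul x (r + t) = smul x r + smul x t"
    and mult: "smul x (r * t) = smul (smul x r) t"
    and one: "smul x 1 = x"
begin

lemma zero_left [simp]: "smul 0 r = 0"
  using add_left[of 0 0 r] by simp

lemma zero_right [simp]: "smul x 0 = 0"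
  using add_right[of x 0 0] by simp

lemma minus_left: "smul (- x) r = - smul x r"
  using add_left[of "- x" x r] by (simp add: eq_neg_iff_add_eq_0)

lemma sum_left: "smul (\<Sum>i\<in>I. f i) r = (\<Sum>i\<in>I. smul (f i) r)"
  by (induction I rule: infinite_finite_induct) (auto simp: add_left)

lemma sum_right: "smul x (\<Sum>i\<in>I. f i) = (\<Sum>i\<in>I. smul x (f i))"
  by (induction I rule: infinite_finite_induct) (auto simp: add_right)

end

lemma right_module_po_right_module: "po_right_module s \<Longrightarrow> right_module s"
  unfolding po_right_module_def right_module_def by auto

lemma right_module_mult: "right_module ((*) :: 'r::{ring,monoid_mult} \<Rightarrow> 'r \<Rightarrow> 'r)"
  by unfold_locales (simp_all add: algebra_simps)

lemma right_module_col_smul: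
  "right_module (col_smul :: (nat \<Rightarrow> 'r::{ring,monoid_mult}) \<Rightarrow> 'r \<Rightarrow> nat \<Rightarrow> 'r)"
  by unfold_locales (simp_all add: col_smul_def fun_eq_iff algebra_simps)

definition prod_smul :: "('a \<Rightarrow> 'r \<Rightarrow> 'a) \<Rightarrow> ('b \<Rightarrow> 'r \<Rightarrow> 'b) \<Rightarrow> 'a \<times> 'b \<Rightarrow> 'r \<Rightarrow> 'a \<times> 'b" where
  "prod_smul s t x r = (s (fst x) r, t (snd x) r)"

lemma right_module_prod_smul:
  assumes "right_module s" "right_module t"
  shows "right_module (prod_smul s t)"
proof -
  interpret s: right_module s by fact
  interpret t: right_module t by fact
  show ?thesis
    by unfold_locales
      (simp_all add: prod_smul_def s.add_left s.add_right s.mult s.one t.add_left t.add_right t.mult t.one)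
qed

definition right_linear ::
    "('a::plus \<Rightarrow> 'r \<Rightarrow> 'a) \<Rightarrow> ('b::plus \<Rightarrow> 'r \<Rightarrow> 'b) \<Rightarrow> ('a \<Rightarrow> 'b) \<Rightarrow> bool" where
  "right_linear s t f \<longleftrightarrow> (\<forall>x y. f (x + y) = f x + f y) \<and> (\<forall>x r. f (s x r) = t (f x) r)"

lemma right_linear_zero:
  fixes f :: "'a::ab_group_add \<Rightarrow> 'b::ab_group_add"
  assumes "right_linear s t f"
  shows "f 0 = 0"
proof -
  have "f (0 + 0) = f 0 + f 0"
    using assms unfolding right_linear_def by blast
  then show ?thesis by simp
qed

lemma right_linear_minus:
  fixes f :: "'a::ab_group_add \<Rightarrow> 'b::ab_group_add"
  assumes "right_linear s t f"
  shows "f (- x) = - f x"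
proof -
  have "f (- x + x) = f (- x) + f x"
    using assms unfolding right_linear_def by blast
  then show ?thesis
    using right_linear_zero[OF assms] by (simp add: eq_neg_iff_add_eq_0)
qed

lemma right_linear_sum:
  fixes f :: "'a::ab_group_add \<Rightarrow> 'b::ab_group_add"
  assumes "right_linear s t f"
  shows "f (\<Sum>i\<in>I. g i) = (\<Sum>i\<in>I. f (g i))"
  by (induction I rule: infinite_finite_induct)
    (use assms right_linear_zero[OF assms] in \<open>auto simp: right_linear_def\<close>)

lemma right_linear_row_mult_comp:
  fixes f :: "'a::ab_group_add \<Rightarrow> 'b::ab_group_add"
  assumes "right_linear s t f"
  shows "f (row_mult s n v X) = row_mult t n (f \<circ> v) X"
  using assms unfolding row_mult_def right_linear_sum[OF assms] by (simp add: right_linear_def)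

lemma right_linear_comp:
  "right_linear s t f \<Longrightarrow> right_linear t u g \<Longrightarrow> right_linear s u (\<lambda>x. g (f x))"
  by (simp add: right_linear_def)

lemma right_linear_diff:
  fixes f g :: "'a::ab_group_add \<Rightarrow> 'b::ab_group_add"
  assumes "right_module t" "right_linear s t f" "right_linear s t g"
  shows "right_linear s t (\<lambda>x. f x - g x)"
  using assms right_module.add_left[OF assms(1)] right_module.minus_left[OF assms(1)]
  by (auto simp: right_linear_def) (metis (no_types) add_uminus_conv_diff)

lemma right_linear_ident: "right_linear s s (\<lambda>x. x)"
  by (simp add: right_linear_def)

lemma right_linear_uminus: "right_module s \<Longrightarrow> right_linear s s uminus"
  by (simp add: right_linear_def right_module.minus_left)

lemma right_linear_row_mult:
  fixes s :: "'a::ab_group_add \<Rightarrow> 'r::{ring,monoid_mult} \<Rightarrow> 'a"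
  assumes "right_module s"
  shows "right_linear col_smul s (row_mult s n v)"
proof -
  interpret right_module s by fact
  show ?thesis
    by (simp add: right_linear_def row_mult_def col_smul_def add_right mult sum.distrib sum_left)
qed

section \<open>Coefficient columns and linear combinations\<close>

text \<open>With \<open>S = UNIV\<close> these are the coefficients for modules, with
  \<open>S = nonneg\<close> those for cones. The condition on the whole range includes the zero tail
  of a column, so it relies on \<open>0 \<in> S\<close>.\<close>

definition coeffs :: "'r::zero set \<Rightarrow> nat \<Rightarrow> (nat \<Rightarrow> 'r) set" where
  "coeffs S n = {X \<in> columns n. range X \<subseteq> S}"

lemma coeffs_UNIV [simp]: "coeffs UNIV n = columns n"
  by (simp add: coeffs_def)

lemma mem_coeffs_nonneg:
  "X \<in> coeffs (nonneg :: 'r::po_ring set) n \<longleftrightarrow> X \<in> columns n \<and> 0 \<le> X"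
  by (auto simp: coeffs_def nonneg_def le_fun_def)

text \<open>The common ground of the two scalar sets \<open>UNIV\<close> and \<open>nonneg\<close>:
  finite generation over \<open>R\<close> and over \<open>R\<^sup>+\<close> is handled by the same
  lemmas.\<close>

definition subsemiring :: "'r::{ring,monoid_mult} set \<Rightarrow> bool" where
  "subsemiring S \<longleftrightarrow> 0 \<in> S \<and> 1 \<in> S \<and> (\<forall>x\<in>S. \<forall>y\<in>S. x + y \<in> S \<and> x * y \<in> S)"

lemma subsemiring_UNIV [simp]: "subsemiring UNIV"
  by (simp add: subsemiring_def)

lemma subsemiring_nonneg [simp]: "subsemiring (nonneg :: 'r::po_ring set)"
  by (auto simp: subsemiring_def nonneg_def zero_le_one')

lemma subsemiring_sum: "subsemiring S \<Longrightarrow> (\<And>i. i \<in> I \<Longrightarrow> f i \<in> S) \<Longrightarrow> sum f I \<in> S"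
  by (induction I rule: infinite_finite_induct) (auto simp: subsemiring_def)

lemma right_subsemimodule_coeffs:
  assumes "subsemiring S"
  shows "right_subsemimodule S col_smul (coeffs S n)"
  using assms by (auto simp: right_subsemimodule_def coeffs_def columns_def col_smul_def subsemiring_def image_subset_iff)

lemma right_subsemimodule_image:
  fixes f :: "'a::ab_group_add \<Rightarrow> 'b::ab_group_add"
  assumes "right_linear s t f" "right_subsemimodule S s M"
  shows "right_subsemimodule S t (f ` M)"
proof -
  have add: "f x + f y = f (x + y)" and smul: "t (f x) r = f (s x r)" for x y r
    using assms(1) unfolding right_linear_def by metis+
  have "0 = f 0"
    using right_linear_zero[OF assms(1)] by simp
  then show ?thesis
    using assms(2) unfolding right_subsemimodule_def ball_simps add smul by blast
qed

lemma row_mult_in: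
  assumes "right_subsemimodule S s M" "v ` {..<n} \<subseteq> M" "X \<in> coeffs S n"
  shows "row_mult s n v X \<in> M"
proof -
  have "(\<Sum>i\<in>I. s (v i) (X i)) \<in> M" if "finite I" "I \<subseteq> {..<n}" for I
    using that
  proof (induction I)
    case (insert i I)
    then have "s (v i) (X i) \<in> M"
      using assms by (auto simp: right_subsemimodule_def coeffs_def image_subset_iff)
    with insert show ?case
      using assms(1) by (auto simp: right_subsemimodule_def)
  qed (use assms(1) in \<open>simp add: right_subsemimodule_def\<close>)
  then show ?thesis
    by (simp add: row_mult_def)
qed

definition unit_col :: "nat \<Rightarrow> nat \<Rightarrow> 'r::{zero,one}" where
  "unit_col i = (\<lambda>j. if j = i then 1 else 0)"

lemma unit_col_in_coeffs: "subsemiring S \<Longrightarrow> i < n \<Longrightarrow> unit_col i \<in> coeffs S n"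
  by (auto simp: unit_col_def coeffs_def columns_def subsemiring_def)

lemma row_mult_unit_col:
  assumes "right_module s" "i < n"
  shows "row_mult s n v (unit_col i) = v i"
proof -
  interpret right_module s by fact
  have "s (v j) (unit_col i j) = (if j = i then v i else 0)" for j
    by (simp add: unit_col_def one)
  then show ?thesis
    using assms(2) by (simp add: row_mult_def)
qed

lemma row_mult_unit_cols:
  fixes X :: "nat \<Rightarrow> 'r::{ring,monoid_mult}"
  assumes "X \<in> columns n"
  shows "row_mult col_smul n unit_col X = X"
proof
  fix j
  have app: "(\<Sum>i\<in>I. F i) j = (\<Sum>i\<in>I. F i j)" for I :: "nat set" and F :: "nat \<Rightarrow> nat \<Rightarrow> 'r"
    by (induction I rule: infinite_finite_induct) auto
  have "col_smul (unit_col i) (X i) j = (if j = i then X j else 0)" for i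
    by (simp add: col_smul_def unit_col_def)
  then show "row_mult col_smul n unit_col X j = X j"
    using assms by (auto simp: row_mult_def app columns_def)
qed

text \<open>Translates between finite generating sets and rows of generators. The two differ when a
  row repeats an entry: one way, the coefficient of a generator goes to a single index; the other
  way, the coefficients of equal entries are added.\<close>

lemma lin_combs_image:
  fixes s :: "'a::ab_group_add \<Rightarrow> 'r::{ring,monoid_mult} \<Rightarrow> 'a"
  assumes "right_module s" "subsemiring S"
  shows "lin_combs S s (v ` {..<n}) = row_mult s n v ` coeffs S n"
proof -
  interpret right_module s by fact
  have S0: "0 \<in> S"
    using assms(2) by (simp add: subsemiring_def)
  show ?thesis
  proof (intro equalityI subsetI)
    fix x assume "x \<in> lin_combs S s (v ` {..<n})"
    then obtain c where c: "\<forall>g\<in>v ` {..<n}. c g \<in> S" and x: "x = (\<Sum>g\<in>v ` {..<n}. s g (c g))"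
      by (auto simp: lin_combs_def)
    \<comment> \<open>\<open>h\<close> selects one index for each value of \<open>v\<close>; all
      other indices will get the coefficient 0.\<close>
    define h where "h = inv_into {..<n} v"
    have h: "h g < n" "v (h g) = g" if "g \<in> v ` {..<n}" for g
      using inv_into_into[OF that] f_inv_into_f[OF that] by (auto simp: h_def)
    define H where "H = h ` v ` {..<n}"
    define X where "X = (\<lambda>i. if i \<in> H then c (v i) else 0)"
    have sub: "H \<subseteq> {..<n}"
      using h by (auto simp: H_def)
    have inj: "inj_on h (v ` {..<n})"
      using h by (metis inj_onI)
    have "row_mult s n v X = (\<Sum>i\<in>H. s (v i) (X i))"
      unfolding row_mult_def by (rule sum.mono_neutral_right) (use sub in \<open>auto simp: X_def\<close>)
    also have "\<dots> = (\<Sum>g\<in>v ` {..<n}. s (v (h g)) (X (h g)))"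
      unfolding H_def by (simp add: sum.reindex[OF inj])
    also have "\<dots> = x"
      unfolding x by (rule sum.cong) (use h in \<open>auto simp: X_def H_def\<close>)
    finally have "x = row_mult s n v X" ..
    moreover have "X \<in> coeffs S n"
      using c sub S0 by (auto simp: X_def coeffs_def columns_def)
    ultimately show "x \<in> row_mult s n v ` coeffs S n" by blast
  next
    fix x assume "x \<in> row_mult s n v ` coeffs S n"
    then obtain X where X: "X \<in> coeffs S n" and x: "x = row_mult s n v X" by blast
    define c where "c g = (\<Sum>i | i < n \<and> v i = g. X i)" for g
    have "x = (\<Sum>g\<in>v ` {..<n}. \<Sum>i | i \<in> {..<n} \<and> v i = g. s (v i) (X i))"
      unfolding x row_mult_def by (rule sum.image_gen) simp
    also have "\<dots> = (\<Sum>g\<in>v ` {..<n}. s g (c g))"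
      by (rule sum.cong) (simp_all add: c_def sum_right)
    finally show "x \<in> lin_combs S s (v ` {..<n})"
      using X unfolding lin_combs_def
      by (auto simp: c_def coeffs_def image_subset_iff intro!: exI[of _ c] subsemiring_sum[OF assms(2)])
  qed
qed

lemma entries_in_row_mult_image:
  assumes "right_module s" "subsemiring S"
  shows "v ` {..<n} \<subseteq> row_mult s n v ` coeffs S n"
proof (rule image_subsetI)
  fix i assume "i \<in> {..<n}"
  then show "v i \<in> row_mult s n v ` coeffs S n"
    using row_mult_unit_col[OF assms(1), of i n v] unit_col_in_coeffs[OF assms(2), of i n]
    by (metis imageI lessThan_iff)
qed

section \<open>Finite generation under images and sums\<close>

lemma finitely_generated_row_mult:
  fixes s :: "'a::ab_group_add \<Rightarrow> 'r::{ring,monoid_mult} \<Rightarrow> 'a"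
  assumes "right_module s" "subsemiring S"
  shows "finitely_generated S s (row_mult s n v ` coeffs S n)"
proof -
  note entries_in_row_mult_image[OF assms, of v n]
  moreover have "right_subsemimodule S s (row_mult s n v ` coeffs S n)"
    by (rule right_subsemimodule_image[OF right_linear_row_mult[OF assms(1)]
        right_subsemimodule_coeffs[OF assms(2)]])
  ultimately show ?thesis
    unfolding finitely_generated_def using lin_combs_image[OF assms]
    by (metis finite_imageI finite_lessThan)
qed

text \<open>The normal form used for the closure properties: a finitely generated set is the linear
  image of the coefficient columns. The bound \<open>1 \<le> n\<close> is kept because spanning
  rows, and with them coherence, concern nonempty rows only.\<close>

lemma finitely_generatedE:
  fixes s :: "'a::ab_group_add \<Rightarrow> 'r::{ring,monoid_mult} \<Rightarrow> 'a"
  assumes "right_module s" "subsemiring S" "finitely_generated S s M"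
  obtains n v where "1 \<le> n" "M = row_mult s n v ` coeffs S n"
proof -
  interpret right_module s by fact
  obtain G where G: "finite G" "M = lin_combs S s G"
    using assms(3) by (auto simp: finitely_generated_def)
  show thesis
  proof (cases "G = {}")
    \<comment> \<open>The empty set generates only 0, which a row with one zero entry generates as
      well.\<close>
    case True
    have "0 \<in> coeffs S 1"
      using assms(2) by (auto simp: coeffs_def columns_def subsemiring_def)
    then have "M = row_mult s 1 (\<lambda>_. 0) ` coeffs S 1"
      using True G by (auto simp: lin_combs_def row_mult_def)
    then show thesis
      using that[of 1] by simp
  next
    case False
    obtain n and v :: "nat \<Rightarrow> 'a" where v: "G = v ` {i. i < n}"
      using finite_imp_nat_seg_image_inj_on[OF G(1)] by blast
    then have "1 \<le> n"
      using False by (cases n) auto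
    moreover have "M = row_mult s n v ` coeffs S n"
      using v G(2) lin_combs_image[OF assms(1,2), of v n] by (simp add: lessThan_def)
    ultimately show thesis by (rule that)
  qed
qed

lemma finitely_generated_image:
  fixes f :: "'a::ab_group_add \<Rightarrow> 'b::ab_group_add"
    and s :: "'a \<Rightarrow> 'r::{ring,monoid_mult} \<Rightarrow> 'a"
  assumes "right_module s" "right_module t" "subsemiring S" "right_linear s t f"
    and "finitely_generated S s M"
  shows "finitely_generated S t (f ` M)"
proof -
  obtain n v where "M = row_mult s n v ` coeffs S n"
    using finitely_generatedE[OF assms(1,3,5)] by metis
  then have "f ` M = row_mult t n (f \<circ> v) ` coeffs S n"
    by (simp add: image_image right_linear_row_mult_comp[OF assms(4)])
  then show ?thesis
    using finitely_generated_row_mult[OF assms(2,3)] by simp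
qed

text \<open>The union of the two generating sets generates the sum, since combinations over either
  set extend by zero coefficients to the union.\<close>

lemma finitely_generated_sum:
  fixes s :: "'a::ab_group_add \<Rightarrow> 'r::{ring,monoid_mult} \<Rightarrow> 'a"
  assumes "right_module s" "subsemiring S" "finitely_generated S s M" "finitely_generated S s N"
  shows "finitely_generated S s {x + y | x y. x \<in> M \<and> y \<in> N}" (is "finitely_generated S s ?L")
proof -
  interpret right_module s by fact
  have M: "right_subsemimodule S s M" and N: "right_subsemimodule S s N"
    using assms by (auto simp: finitely_generated_def)
  then have zero_M: "0 \<in> M" and zero_N: "0 \<in> N"
    by (auto simp: right_subsemimodule_def)
  obtain G where G: "finite G" "G \<subseteq> M" "M = lin_combs S s G"
    using assms by (auto simp: finitely_generated_def)
  obtain H where H: "finite H" "H \<subseteq> N" "N = lin_combs S s H"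
    using assms by (auto simp: finitely_generated_def)
  have sub: "right_subsemimodule S s ?L"
    unfolding right_subsemimodule_def
  proof (intro conjI ballI)
    show "0 \<in> ?L"
      using zero_M zero_N add_0_right[of 0, symmetric] by blast
  next
    fix x y assume "x \<in> ?L" "y \<in> ?L"
    then obtain a b c d where "x = a + b" "y = c + d" "a \<in> M" "c \<in> M" "b \<in> N" "d \<in> N" by blast
    moreover from this have "x + y = (a + c) + (b + d)" by (simp add: algebra_simps)
    ultimately show "x + y \<in> ?L"
      using M N unfolding right_subsemimodule_def by blast
  next
    fix x r assume "x \<in> ?L" "r \<in> S"
    then obtain a b where "x = a + b" "a \<in> M" "b \<in> N" by blast
    moreover from this have "s x r = s a r + s b r" by (simp add: add_left)
    ultimately show "s x r \<in> ?L"
      using M N \<open>r \<in> S\<close> unfolding right_subsemimodule_def by blast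
  qed
  obtain n and v :: "nat \<Rightarrow> 'a" where v: "G \<union> H = v ` {i. i < n}"
    using finite_imp_nat_seg_image_inj_on[of "G \<union> H"] G(1) H(1) by blast
  have sum: "(\<Sum>g\<in>K. s g (c g)) \<in> lin_combs S s (G \<union> H)"
    if "K \<subseteq> G \<union> H" "\<forall>g\<in>K. c g \<in> S" for K c
  proof -
    have "(\<Sum>g\<in>K. s g (c g)) = (\<Sum>g\<in>G \<union> H. s g (if g \<in> K then c g else 0))"
      by (rule sum.mono_neutral_cong_left) (use that G(1) H(1) in auto)
    then show ?thesis
      unfolding lin_combs_def using that assms(2) by (auto simp: subsemiring_def)
  qed
  have span: "right_subsemimodule S s (lin_combs S s (G \<union> H))"
    using finitely_generated_row_mult[OF assms(1,2), of n v] lin_combs_image[OF assms(1,2), of v n] v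
    by (simp add: finitely_generated_def lessThan_def)
  have "M \<subseteq> ?L" "N \<subseteq> ?L"
    using add_0_right add_0_left zero_M zero_N by (metis (mono_tags, lifting) mem_Collect_eq subsetI)+
  then have GH: "G \<union> H \<subseteq> ?L"
    using G(2) H(2) by blast
  have "?L = lin_combs S s (G \<union> H)"
  proof
    have "M \<subseteq> lin_combs S s (G \<union> H)" "N \<subseteq> lin_combs S s (G \<union> H)"
      unfolding G(3) H(3) using sum[of G] sum[of H] by (auto simp: lin_combs_def[of _ _ G] lin_combs_def[of _ _ H])
    then show "?L \<subseteq> lin_combs S s (G \<union> H)"
      using span by (auto simp: right_subsemimodule_def)
    show "lin_combs S s (G \<union> H) \<subseteq> ?L"
      using row_mult_in[OF sub] GH lin_combs_image[OF assms(1,2), of v n] v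
      by (auto simp: lessThan_def)
  qed
  then show ?thesis
    unfolding finitely_generated_def using sub GH G(1) H(1) by blast
qed

section \<open>Columns as finitely generated cones\<close>

lemma finitely_generated_nonneg_coeffs:
  "finitely_generated nonneg col_smul (coeffs (nonneg :: 'r::po_ring set) n)"
proof -
  have "row_mult col_smul n unit_col ` coeffs (nonneg :: 'r set) n = (\<lambda>X. X) ` coeffs nonneg n"
    by (rule image_cong) (simp_all add: coeffs_def row_mult_unit_cols)
  then have "row_mult col_smul n unit_col ` coeffs (nonneg :: 'r set) n = coeffs nonneg n"
    by simp
  then show ?thesis
    using finitely_generated_row_mult[OF right_module_col_smul subsemiring_nonneg] by metis
qed

text \<open>Directedness of \<open>R\<close> enters here: splitting every entry into a difference of
  nonnegative elements writes \<open>columns n\<close> as the sum of the nonnegative cone and its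
  negative.\<close>

lemma finitely_generated_nonneg_columns:
  "finitely_generated nonneg col_smul (columns n :: (nat \<Rightarrow> 'r::po_ring) set)"
proof -
  let ?P = "coeffs (nonneg :: 'r set) n"
  have "columns n = {x + y | x y. x \<in> ?P \<and> y \<in> uminus ` ?P}"
  proof (intro equalityI subsetI)
    fix X :: "nat \<Rightarrow> 'r" assume X: "X \<in> columns n"
    have "\<forall>i. \<exists>y z. 0 \<le> y \<and> 0 \<le> z \<and> X i = y - z"
      using directed by blast
    then obtain Y Z where YZ: "0 \<le> Y i" "0 \<le> Z i" "X i = Y i - Z i" for i
      by metis
    \<comment> \<open>From \<open>n\<close> on the chosen \<open>Y i\<close> and \<open>Z i\<close>
      are equal but possibly nonzero, so both are truncated to obtain columns of length
      \<open>n\<close>.\<close>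
    define Y' Z' where "Y' i = (if i < n then Y i else 0)" and "Z' i = (if i < n then Z i else 0)" for i
    have "X = Y' + - Z'"
      using X YZ by (auto simp: Y'_def Z'_def columns_def fun_eq_iff)
    moreover have "Y' \<in> ?P" "Z' \<in> ?P"
      using YZ by (auto simp: Y'_def Z'_def mem_coeffs_nonneg columns_def le_fun_def)
    ultimately show "X \<in> {x + y | x y. x \<in> ?P \<and> y \<in> uminus ` ?P}" by blast
  qed (auto simp: mem_coeffs_nonneg columns_def)
  then show ?thesis
    using finitely_generated_sum[OF right_module_col_smul subsemiring_nonneg
        finitely_generated_nonneg_coeffs
        finitely_generated_image[OF right_module_col_smul right_module_col_smul subsemiring_nonneg
          right_linear_uminus[OF right_module_col_smul] finitely_generated_nonneg_coeffs]]
    by simp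
qed

text \<open>A finitely generated module is a linear image of some \<open>columns n\<close>, which is
  a finitely generated cone. Conversely, generators over \<open>R\<^sup>+\<close> also generate over
  \<open>R\<close>, because closure under all scalars keeps their combinations inside
  \<open>M\<close>.\<close>

lemma finitely_generated_UNIV_iff_nonneg:
  fixes s :: "'a::ab_group_add \<Rightarrow> 'r::po_ring \<Rightarrow> 'a"
  assumes s: "right_module s"
  shows "finitely_generated UNIV s M \<longleftrightarrow>
    right_subsemimodule UNIV s M \<and> finitely_generated nonneg s M"
proof
  assume M: "finitely_generated UNIV s M"
  then obtain n v where "M = row_mult s n v ` columns n"
    using finitely_generatedE[OF s subsemiring_UNIV] by (metis coeffs_UNIV)
  then have "finitely_generated nonneg s M"
    using finitely_generated_image[OF right_module_col_smul s subsemiring_nonneg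
        right_linear_row_mult[OF s] finitely_generated_nonneg_columns] by simp
  then show "right_subsemimodule UNIV s M \<and> finitely_generated nonneg s M"
    using M by (simp add: finitely_generated_def)
next
  assume M: "right_subsemimodule UNIV s M \<and> finitely_generated nonneg s M"
  then obtain n v where v: "M = row_mult s n v ` coeffs nonneg n"
    using finitely_generatedE[OF s subsemiring_nonneg] by metis
  have "v ` {..<n} \<subseteq> M"
    unfolding v by (rule entries_in_row_mult_image[OF s subsemiring_nonneg])
  then have "row_mult s n v ` columns n \<subseteq> M"
    using row_mult_in M by (metis coeffs_UNIV image_subsetI)
  moreover have "M \<subseteq> row_mult s n v ` columns n"
    unfolding v by (auto simp: coeffs_def)
  ultimately have "M = row_mult s n v ` coeffs UNIV n" by simp
  then show "finitely_generated UNIV s M"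
    using finitely_generated_row_mult[OF s subsemiring_UNIV] by simp
qed

section \<open>Spanning rows and coherence\<close>

lemma spanning_UNIV_iff:
  fixes s :: "'a::ab_group_add \<Rightarrow> 'r::{ring,monoid_mult} \<Rightarrow> 'a"
  assumes "right_module s"
  shows "spanning s UNIV n U \<longleftrightarrow> 1 \<le> n \<and> (\<forall>a. \<exists>X\<in>columns n. a = row_mult s n U X)"
  unfolding spanning_def lin_combs_image[OF assms subsemiring_UNIV] by auto

lemma finitely_generated_UNIV_spanning:
  fixes s :: "'a::ab_group_add \<Rightarrow> 'r::{ring,monoid_mult} \<Rightarrow> 'a"
  assumes "right_module s" "spanning s UNIV n U"
  shows "finitely_generated UNIV s UNIV"
proof -
  have "row_mult s n U ` columns n = UNIV"
    using assms by (auto simp: spanning_UNIV_iff)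
  then show ?thesis
    using finitely_generated_row_mult[OF assms(1) subsemiring_UNIV, of n U] by simp
qed

lemma finitely_generated_UNIV_obtain_spanning:
  fixes s :: "'a::ab_group_add \<Rightarrow> 'r::{ring,monoid_mult} \<Rightarrow> 'a"
  assumes "right_module s" "finitely_generated UNIV s UNIV"
  obtains n U where "spanning s UNIV n U"
proof -
  obtain n U where "1 \<le> n" "UNIV = row_mult s n U ` coeffs UNIV n"
    using finitely_generatedE[OF assms(1) subsemiring_UNIV assms(2)] by blast
  then have "spanning s UNIV n U"
    using assms(1) by (auto simp: spanning_UNIV_iff)
  then show thesis by (rule that)
qed

text \<open>Any nonempty row spans the submodule generated by its entries, and coherence makes that
  submodule finitely related.\<close>

lemma po_coherent_finitely_related_at:
  fixes s :: "'a::ordered_ab_group_add \<Rightarrow> 'r::po_ring \<Rightarrow> 'a"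
  assumes "po_coherent s" "right_module s" "1 \<le> n"
  shows "finitely_related_at s n U"
proof -
  let ?M = "lin_combs UNIV s (U ` {..<n})"
  have M: "?M = row_mult s n U ` coeffs UNIV n"
    by (rule lin_combs_image[OF assms(2) subsemiring_UNIV])
  have "finitely_generated UNIV s ?M"
    unfolding M by (rule finitely_generated_row_mult[OF assms(2) subsemiring_UNIV])
  moreover have "spanning s ?M n U"
    unfolding spanning_def
    using assms(3) entries_in_row_mult_image[OF assms(2) subsemiring_UNIV] M by simp
  ultimately show ?thesis
    using assms(1) by (auto simp: po_coherent_def finitely_related_def)
qed

section \<open>Cutting cones by inequalities and equations\<close>

text \<open>In terms of the coefficients \<open>Y\<close> of a generating row \<open>v\<close>, the
  condition \<open>0 \<le> f x\<close> becomes nonnegativity of the row \<open>f \<circ> v\<close>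
  applied to \<open>Y\<close>, and finite relatedness at that row is what is needed. As
  \<open>related\<close> concerns only rows generating \<open>M\<close>, it can come from coherence
  of \<open>R\<close> or from a finitely related target on which \<open>f \<circ> v\<close>
  spans.\<close>

lemma finitely_generated_halfspace:
  fixes s :: "'a::ab_group_add \<Rightarrow> 'r::po_ring \<Rightarrow> 'a"
    and t :: "'b::ordered_ab_group_add \<Rightarrow> 'r \<Rightarrow> 'b"
  assumes "right_module s" "right_linear s t f" "finitely_generated nonneg s M"
    and related: "\<And>n v. 1 \<le> n \<Longrightarrow> M = row_mult s n v ` coeffs nonneg n \<Longrightarrow> finitely_related_at t n (f \<circ> v)"
  shows "finitely_generated nonneg s {x \<in> M. 0 \<le> f x}"
proof -
  obtain n v where n: "1 \<le> n" and M: "M = row_mult s n v ` coeffs nonneg n"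
    using finitely_generatedE[OF assms(1) subsemiring_nonneg assms(3)] .
  have "{x \<in> M. 0 \<le> f x} =
      row_mult s n v ` {Y \<in> columns n. 0 \<le> row_mult t n (f \<circ> v) Y \<and> 0 \<le> Y}"
    unfolding M right_linear_row_mult_comp[OF assms(2), symmetric] by (auto simp: mem_coeffs_nonneg)
  then show ?thesis
    using finitely_generated_image[OF right_module_col_smul assms(1) subsemiring_nonneg
        right_linear_row_mult[OF assms(1)] related[OF n M, unfolded finitely_related_at_def]]
    by simp
qed

text \<open>An equation is a pair of opposite inequalities; since \<open>f\<close> takes values in
  \<open>R\<close>, coherence permits both cuts.\<close>

lemma finitely_generated_hyperplane:
  fixes s :: "'a::ab_group_add \<Rightarrow> 'r::po_ring \<Rightarrow> 'a"
  assumes coh: "po_coherent ((*) :: 'r \<Rightarrow> 'r \<Rightarrow> 'r)"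
    and s: "right_module s" and f: "right_linear s (*) f" and M: "finitely_generated nonneg s M"
  shows "finitely_generated nonneg s {x \<in> M. f x = 0}"
proof -
  note half = finitely_generated_halfspace[OF s _ _ po_coherent_finitely_related_at[OF coh right_module_mult]]
  have "right_linear s (*) (\<lambda>x. - f x)"
    using right_linear_comp[OF f right_linear_uminus[OF right_module_mult]] .
  from half[OF this half[OF f M]] have "finitely_generated nonneg s {x \<in> {x \<in> M. 0 \<le> f x}. 0 \<le> - f x}"
    by simp
  moreover have "{x \<in> {x \<in> M. 0 \<le> f x}. 0 \<le> - f x} = {x \<in> M. f x = 0}"
    by auto
  ultimately show ?thesis by simp
qed

text \<open>The product is the sum of the images of \<open>M\<close> and \<open>N\<close> under the
  two coordinate embeddings.\<close>

lemma finitely_generated_Times: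
  fixes s :: "'a::ab_group_add \<Rightarrow> 'r::{ring,monoid_mult} \<Rightarrow> 'a"
    and t :: "'b::ab_group_add \<Rightarrow> 'r \<Rightarrow> 'b"
  assumes s: "right_module s" and t: "right_module t" and S: "subsemiring S"
    and M: "finitely_generated S s M" and N: "finitely_generated S t N"
  shows "finitely_generated S (prod_smul s t) (M \<times> N)"
proof -
  note st = right_module_prod_smul[OF s t]
  have "right_linear s (prod_smul s t) (\<lambda>x. (x, 0))" "right_linear t (prod_smul s t) (\<lambda>y. (0, y))"
    using right_module.zero_left[OF s] right_module.zero_left[OF t]
    by (auto simp: right_linear_def prod_smul_def)
  from finitely_generated_sum[OF st S finitely_generated_image[OF s st S this(1) M]
      finitely_generated_image[OF t st S this(2) N]] show ?thesis
    by (rule back_subst[of "finitely_generated S (prod_smul s t)"]) force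
qed

lemma finitely_generated_Int_columns:
  fixes C D :: "(nat \<Rightarrow> 'r::po_ring) set"
  assumes coh: "po_coherent ((*) :: 'r \<Rightarrow> 'r \<Rightarrow> 'r)"
    and C: "finitely_generated nonneg col_smul C" "C \<subseteq> columns n"
    and D: "finitely_generated nonneg col_smul D" "D \<subseteq> columns n"
  shows "finitely_generated nonneg col_smul (C \<inter> D)"
proof -
  let ?s = "prod_smul col_smul col_smul :: _ \<Rightarrow> 'r \<Rightarrow> (nat \<Rightarrow> 'r) \<times> (nat \<Rightarrow> 'r)"
  have s: "right_module ?s"
    by (intro right_module_prod_smul right_module_col_smul)
  \<comment> \<open>The equations between corresponding entries are imposed one at a time, by
    induction on their number \<open>m\<close>; the case \<open>m = n\<close> cuts out the diagonal
    copy of \<open>C \<inter> D\<close>.\<close>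
  have "finitely_generated nonneg ?s {z \<in> C \<times> D. \<forall>i<m. fst z i = snd z i}" for m
  proof (induction m)
    case 0
    then show ?case
      using finitely_generated_Times[OF right_module_col_smul right_module_col_smul subsemiring_nonneg
          C(1) D(1)] by simp
  next
    case (Suc m)
    have "right_linear ?s (*) (\<lambda>z. fst z m - snd z m)"
      by (auto simp: right_linear_def prod_smul_def col_smul_def algebra_simps)
    from finitely_generated_hyperplane[OF coh s this Suc] show ?case
      by (rule back_subst[of "finitely_generated nonneg ?s"]) (auto simp: less_Suc_eq)
  qed
  moreover have "right_linear ?s col_smul fst"
    by (simp add: right_linear_def prod_smul_def)
  ultimately have "finitely_generated nonneg col_smul (fst ` {z \<in> C \<times> D. \<forall>i<n. fst z i = snd z i})"
    by (intro finitely_generated_image[OF s right_module_col_smul subsemiring_nonneg])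
  moreover have "fst ` {z \<in> C \<times> D. \<forall>i<n. fst z i = snd z i} = C \<inter> D"
  proof (intro equalityI subsetI)
    fix X assume "X \<in> fst ` {z \<in> C \<times> D. \<forall>i<n. fst z i = snd z i}"
    then obtain Y where Y: "X \<in> C" "Y \<in> D" "\<forall>i<n. X i = Y i" by auto
    \<comment> \<open>Both columns vanish from \<open>n\<close> on, so agreement of the first
      \<open>n\<close> entries suffices.\<close>
    moreover from Y have "X = Y"
      using C(2) D(2) unfolding columns_def by (auto simp: fun_eq_iff subset_iff) (metis not_le)
    ultimately show "X \<in> C \<inter> D" by simp
  qed force
  ultimately show ?thesis by simp
qed

section \<open>Kernels of spanning rows\<close>

lemma right_subsemimodule_kernel:
  fixes s :: "'a::ab_group_add \<Rightarrow> 'r::{ring,monoid_mult} \<Rightarrow> 'a"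
  assumes "right_module s"
  shows "right_subsemimodule UNIV col_smul {X \<in> columns n. row_mult s n U X = 0}"
  using right_linear_row_mult[OF assms, of n U] right_linear_zero[OF right_linear_row_mult[OF assms, of n U]]
    right_module.zero_left[OF assms]
  by (auto simp: right_subsemimodule_def right_linear_def columns_def col_smul_def)

text \<open>Read \<open>B\<close> as the matrix with columns \<open>B j\<close>; then
  \<open>row_mult col_smul m B X\<close> is the matrix product \<open>B X\<close>. Taking for
  \<open>B j\<close> a preimage of \<open>U j\<close> under \<open>W\<close> gives
  \<open>W B = U\<close>.\<close>

lemma spanning_lift:
  fixes s :: "'a::ab_group_add \<Rightarrow> 'r::{ring,monoid_mult} \<Rightarrow> 'a"
  assumes "right_module s" "spanning s UNIV n W"
  shows "\<exists>B. (\<forall>j. B j \<in> columns n) \<and>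
    (\<forall>X. row_mult s n W (row_mult col_smul m B X) = row_mult s m U X)"
proof -
  have "\<forall>j. \<exists>X. X \<in> columns n \<and> U j = row_mult s n W X"
    using assms(2) unfolding spanning_UNIV_iff[OF assms(1)] by blast
  then obtain B where B: "B j \<in> columns n" "U j = row_mult s n W (B j)" for j
    by metis
  have "row_mult s n W \<circ> B = U"
    using B by auto
  then show ?thesis
    using B(1) right_linear_row_mult_comp[OF right_linear_row_mult[OF assms(1)], of n W m B] by auto
qed

lemma row_mult_in_columns:
  fixes B :: "nat \<Rightarrow> nat \<Rightarrow> 'r::{ring,monoid_mult}"
  assumes "\<And>j. B j \<in> columns n" "X \<in> columns m"
  shows "row_mult col_smul m B X \<in> columns n"
  using row_mult_in[of UNIV col_smul "columns n" B m X] right_subsemimodule_coeffs[OF subsemiring_UNIV, of n]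
    assms by auto

text \<open>Schanuel's argument: if \<open>U = W P\<close> and \<open>W = U Q\<close>, then \<open>ker W = (1 - P Q) R\<^sup>n + P (ker U)\<close>.\<close>

lemma finitely_generated_kernel_spanning:
  fixes s :: "'a::ab_group_add \<Rightarrow> 'r::po_ring \<Rightarrow> 'a"
  assumes s: "right_module s" and U: "spanning s UNIV m U" and W: "spanning s UNIV n W"
    and K: "finitely_generated nonneg col_smul {X \<in> columns m. row_mult s m U X = 0}"
  shows "finitely_generated nonneg col_smul {X \<in> columns n. row_mult s n W X = 0}"
proof -
  obtain P where P: "\<And>j. P j \<in> columns n"
    "\<And>X. row_mult s n W (row_mult col_smul m P X) = row_mult s m U X"
    using spanning_lift[OF s W, where m = m and U = U] by metis
  obtain Q where Q: "\<And>j. Q j \<in> columns m"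
    "\<And>X. row_mult s m U (row_mult col_smul n Q X) = row_mult s n W X"
    using spanning_lift[OF s U, where m = n and U = W] by metis
  let ?p = "row_mult col_smul m P" and ?q = "row_mult col_smul n Q"
  let ?h = "\<lambda>X. X - ?p (?q X)"
  let ?KU = "{X \<in> columns m. row_mult s m U X = 0}" and ?KW = "{X \<in> columns n. row_mult s n W X = 0}"
  note lin = right_linear_row_mult[OF right_module_col_smul]
  note img = finitely_generated_image[OF right_module_col_smul right_module_col_smul subsemiring_nonneg]
  have h: "right_linear col_smul col_smul ?h"
    by (intro right_linear_diff right_module_col_smul right_linear_ident right_linear_comp[OF lin lin])
  have W_diff: "row_mult s n W (X + Y) = row_mult s n W X + row_mult s n W Y"
    "row_mult s n W (- X) = - row_mult s n W X" for X Y
    using right_linear_row_mult[OF s, of n W] right_linear_minus[OF right_linear_row_mult[OF s]]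
    by (auto simp: right_linear_def)
  \<comment> \<open>Here \<open>?h\<close> is \<open>1 - P Q\<close>. It maps into the kernel of
    \<open>W\<close> because \<open>W P Q = U Q = W\<close>, and \<open>P\<close> maps the kernel of
    \<open>U\<close> there because \<open>W P = U\<close>. Conversely, \<open>W Z = 0\<close> gives
    \<open>U Q Z = 0\<close>, and \<open>Z = (1 - P Q) Z + P (Q Z)\<close>.\<close>
  have eq: "{x + y | x y. x \<in> ?h ` columns n \<and> y \<in> ?p ` ?KU} = ?KW"
  proof (intro equalityI subsetI)
    fix Z assume "Z \<in> {x + y | x y. x \<in> ?h ` columns n \<and> y \<in> ?p ` ?KU}"
    then obtain X Y where Z: "Z = X + - ?p (?q X) + ?p Y"
      and X: "X \<in> columns n" and Y: "Y \<in> columns m" "row_mult s m U Y = 0" by auto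
    have "?p (?q X) \<in> columns n" "?p Y \<in> columns n"
      using P(1) Q(1) X Y by (auto intro!: row_mult_in_columns)
    then have "Z \<in> columns n"
      using X Z by (auto simp: columns_def)
    moreover have "row_mult s n W Z = 0"
      unfolding Z W_diff P(2) Q(2) using Y by simp
    ultimately show "Z \<in> ?KW" by simp
  next
    fix Z assume Z: "Z \<in> ?KW"
    then have "Z = ?h Z + ?p (?q Z)" "?q Z \<in> ?KU"
      using Q by (auto intro!: row_mult_in_columns)
    then show "Z \<in> {x + y | x y. x \<in> ?h ` columns n \<and> y \<in> ?p ` ?KU}"
      using Z by blast
  qed
  show ?thesis
    unfolding eq[symmetric]
    by (intro finitely_generated_sum[OF right_module_col_smul subsemiring_nonneg]
        img[OF h finitely_generated_nonneg_columns] img[OF lin K])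
qed

section \<open>The three implications\<close>

lemma finitely_related_imp_finitely_po_presented:
  fixes s :: "'a::ordered_ab_group_add \<Rightarrow> 'r::po_ring \<Rightarrow> 'a"
  assumes s: "right_module s" and rel: "finitely_related s UNIV"
  shows "finitely_po_presented s"
proof -
  obtain n U where U: "spanning s UNIV n U"
    using finitely_generated_UNIV_obtain_spanning[OF s] rel by (auto simp: finitely_related_def)
  let ?f = "row_mult s n U"
  have "finitely_generated nonneg col_smul {X \<in> columns n. 0 \<le> ?f X}"
  proof (rule finitely_generated_halfspace)
    fix k :: nat and v :: "nat \<Rightarrow> nat \<Rightarrow> 'r"
    assume k: "1 \<le> k" and v: "columns n = row_mult col_smul k v ` coeffs nonneg k"
    \<comment> \<open>The generators \<open>v\<close> of \<open>columns n\<close> as a cone,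
      followed by \<open>U\<close>, still span the module, so finite relatedness applies to this
      row.\<close>
    have "\<exists>X\<in>columns k. a = row_mult s k (?f \<circ> v) X" for a
    proof -
      obtain Y where "Y \<in> columns n" "a = ?f Y"
        using U by (auto simp: spanning_UNIV_iff[OF s])
      moreover from this obtain X where "X \<in> columns k" "Y = row_mult col_smul k v X"
        using v by (auto simp: coeffs_def)
      ultimately show ?thesis
        by (auto simp: right_linear_row_mult_comp[OF right_linear_row_mult[OF s]])
    qed
    then have "spanning s UNIV k (?f \<circ> v)"
      using k by (simp add: spanning_UNIV_iff[OF s])
    then show "finitely_related_at s k (?f \<circ> v)"
      using rel by (simp add: finitely_related_def)
  qed (intro right_module_col_smul right_linear_row_mult[OF s] finitely_generated_nonneg_columns)+
  then show ?thesis
    using U by (auto simp: finitely_po_presented_def finitely_po_presented_at_def)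
qed

lemma finitely_po_presented_imp:
  fixes s :: "'a::ordered_ab_group_add \<Rightarrow> 'r::po_ring \<Rightarrow> 'a"
  assumes coh: "po_coherent ((*) :: 'r \<Rightarrow> 'r \<Rightarrow> 'r)"
    and s: "right_module s" and pres: "finitely_po_presented s"
  shows "finitely_presented s \<and> finitely_generated nonneg s {a. 0 \<le> a}"
proof -
  obtain n U where U: "spanning s UNIV n U"
    and C: "finitely_generated nonneg col_smul {X \<in> columns n. 0 \<le> row_mult s n U X}"
    using pres by (auto simp: finitely_po_presented_def finitely_po_presented_at_def)
  let ?f = "row_mult s n U" and ?C = "{X \<in> columns n. 0 \<le> row_mult s n U X}"
  note f = right_linear_row_mult[OF s, of n U]
  have minus: "?f (- X) = - ?f X" for X
    by (rule right_linear_minus[OF f])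
  \<comment> \<open>Surjectivity of \<open>?f\<close> provides a preimage of every nonnegative
    element, and such a preimage lies in \<open>?C\<close>.\<close>
  have "?f ` ?C = {a. 0 \<le> a}"
  proof (intro equalityI subsetI)
    fix a :: 'a assume "a \<in> {a. 0 \<le> a}"
    moreover obtain X where "X \<in> columns n" "a = ?f X"
      using U unfolding spanning_UNIV_iff[OF s] by blast
    ultimately show "a \<in> ?f ` ?C" by blast
  qed blast
  then have pos: "finitely_generated nonneg s {a. 0 \<le> a}"
    using finitely_generated_image[OF right_module_col_smul s subsemiring_nonneg f C] by simp
  \<comment> \<open>By antisymmetry of the order on the module, \<open>?f X\<close> and its negative
    are both nonnegative only when \<open>?f X = 0\<close>.\<close>
  have "?C \<inter> uminus ` ?C = {X \<in> columns n. ?f X = 0}"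
  proof (intro equalityI subsetI)
    fix X assume "X \<in> {X \<in> columns n. ?f X = 0}"
    then have "X \<in> ?C" "- X \<in> ?C"
      by (auto simp: minus columns_def)
    then show "X \<in> ?C \<inter> uminus ` ?C"
      using imageI[of "- X" ?C uminus] by simp
  qed (auto simp: minus)
  moreover have "?C \<subseteq> columns n" "uminus ` ?C \<subseteq> columns n"
    by (auto simp: columns_def)
  moreover have "finitely_generated nonneg col_smul (uminus ` ?C)"
    by (rule finitely_generated_image[OF right_module_col_smul right_module_col_smul
          subsemiring_nonneg right_linear_uminus[OF right_module_col_smul] C])
  ultimately have "finitely_generated nonneg col_smul {X \<in> columns n. ?f X = 0}"
    using finitely_generated_Int_columns[OF coh C, of n "uminus ` ?C"] by simp
  \<comment> \<open>The kernel is closed under all scalars, so its finite generation as a cone gives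
    finite generation as a module.\<close>
  then have "finitely_generated UNIV col_smul {X \<in> columns n. ?f X = 0}"
    using finitely_generated_UNIV_iff_nonneg[OF right_module_col_smul] right_subsemimodule_kernel[OF s]
    by blast
  then show ?thesis
    using U pos by (auto simp: finitely_presented_def)
qed

lemma finitely_presented_imp_finitely_related:
  fixes s :: "'a::ordered_ab_group_add \<Rightarrow> 'r::po_ring \<Rightarrow> 'a"
  assumes coh: "po_coherent ((*) :: 'r \<Rightarrow> 'r \<Rightarrow> 'r)"
    and s: "right_module s" and pres: "finitely_presented s"
    and pos: "finitely_generated nonneg s {a. 0 \<le> a}"
  shows "finitely_related s UNIV"
proof -
  obtain m U where U: "spanning s UNIV m U"
    and "finitely_generated UNIV col_smul {X \<in> columns m. row_mult s m U X = 0}"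
    using pres by (auto simp: finitely_presented_def)
  then have KU: "finitely_generated nonneg col_smul {X \<in> columns m. row_mult s m U X = 0}"
    by (simp add: finitely_generated_UNIV_iff_nonneg[OF right_module_col_smul])
  have "finitely_related_at s n W" if W: "spanning s UNIV n W" for n W
  proof -
    let ?K = "{X \<in> columns n. row_mult s n W X = 0}" and ?C = "{X \<in> columns n. 0 \<le> row_mult s n W X}"
    obtain k a where a: "{a. 0 \<le> a} = row_mult s k a ` coeffs nonneg k"
      using finitely_generatedE[OF s subsemiring_nonneg pos] .
    \<comment> \<open>The columns of \<open>B\<close> lift the generators \<open>a\<close> of the
      positive cone along \<open>W\<close>, that is, \<open>W B = a\<close>.\<close>
    obtain B where B: "\<And>j. B j \<in> columns n"
      "\<And>X. row_mult s n W (row_mult col_smul k B X) = row_mult s k a X"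
      using spanning_lift[OF s W, where m = k and U = a] by metis
    let ?b = "row_mult col_smul k B"
    have W_diff: "row_mult s n W (X + Y) = row_mult s n W X + row_mult s n W Y"
      "row_mult s n W (- X) = - row_mult s n W X" for X Y
      using right_linear_row_mult[OF s, of n W] right_linear_minus[OF right_linear_row_mult[OF s]]
      by (auto simp: right_linear_def)
    have b: "?b Y \<in> columns n" if "Y \<in> coeffs nonneg k" for Y
      using that B(1) by (auto simp: coeffs_def intro!: row_mult_in_columns)
    \<comment> \<open>For \<open>Z\<close> in \<open>?C\<close>, the value \<open>W Z\<close> is
      nonnegative and hence of the form \<open>a Y = W B Y\<close> with \<open>Y\<close>
      nonnegative; then \<open>Z - B Y\<close> lies in the kernel.\<close>
    have eq: "{x + y | x y. x \<in> ?b ` coeffs nonneg k \<and> y \<in> ?K} = ?C"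
    proof (intro equalityI subsetI)
      fix Z assume "Z \<in> {x + y | x y. x \<in> ?b ` coeffs nonneg k \<and> y \<in> ?K}"
      then obtain Y X where Z: "Z = ?b Y + X" and Y: "Y \<in> coeffs nonneg k"
        and X: "X \<in> columns n" "row_mult s n W X = 0" by blast
      have "0 \<le> row_mult s k a Y"
        using a Y by blast
      then show "Z \<in> ?C"
        using b[OF Y] X unfolding Z by (auto simp: W_diff B(2) columns_def)
    next
      fix Z assume Z: "Z \<in> ?C"
      then obtain Y where Y: "Y \<in> coeffs nonneg k" "row_mult s n W Z = row_mult s k a Y"
        using a by blast
      have "Z + - ?b Y \<in> ?K"
        using Z Y b[OF Y(1)] by (auto simp: W_diff(1) W_diff(2) B(2) columns_def simp del: add_uminus_conv_diff)
      moreover have "Z = ?b Y + (Z + - ?b Y)" by simp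
      ultimately show "Z \<in> {x + y | x y. x \<in> ?b ` coeffs nonneg k \<and> y \<in> ?K}"
        using Y(1) by blast
    qed
    have "finitely_generated nonneg col_smul ?C"
      unfolding eq[symmetric]
      by (intro finitely_generated_sum[OF right_module_col_smul subsemiring_nonneg]
          finitely_generated_row_mult[OF right_module_col_smul subsemiring_nonneg]
          finitely_generated_kernel_spanning[OF s U W KU])
    \<comment> \<open>Finite relatedness also demands \<open>0 \<le> X\<close>; coherence enters
      through this intersection with the nonnegative columns.\<close>
    then have "finitely_generated nonneg col_smul (?C \<inter> coeffs nonneg n)"
      by (intro finitely_generated_Int_columns[OF coh, of _ n] finitely_generated_nonneg_coeffs)
        (auto simp: coeffs_def)
    moreover have "?C \<inter> coeffs nonneg n = {X \<in> columns n. 0 \<le> row_mult s n W X \<and> 0 \<le> X}"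
      by (auto simp: mem_coeffs_nonneg)
    ultimately show ?thesis
      by (simp add: finitely_related_at_def)
  qed
  then show ?thesis
    using finitely_generated_UNIV_spanning[OF s U] by (simp add: finitely_related_def)
qed

theorem theorem4p2:
  fixes smul :: "'a::ordered_ab_group_add \<Rightarrow> 'r::po_ring \<Rightarrow> 'a"
  assumes "po_coherent ((*) :: 'r \<Rightarrow> 'r \<Rightarrow> 'r)"
    and "po_right_module smul"
  shows "(finitely_po_presented smul \<longleftrightarrow> finitely_related smul UNIV) \<and>
    (finitely_related smul UNIV \<longleftrightarrow>
      finitely_presented smul \<and> finitely_generated nonneg smul {a. 0 \<le> a})"
proof -
  note s = right_module_po_right_module[OF assms(2)]
  show ?thesis
    using finitely_related_imp_finitely_po_presented[OF s] finitely_po_presented_imp[OF assms(1) s]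
      finitely_presented_imp_finitely_related[OF assms(1) s] by blast
qed

end
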